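(* For all real $x$ with $0<x\le \frac{\pi}{2}$ one has $$\frac{1-\cos x}{x}\le \frac{2}{\pi}+\frac{2(\pi-2)}{\pi^2}\left(x-\frac{\pi}{2}\right).$$ *)

theory Defs imports Complex_Main begin

end

(* The function (1 - cos t) / t is concave on the interval from 0 to pi / 2, and the
   right-hand side is its tangent line at pi / 2. *)
theory Submission imports Defs "HOL-Analysis.Convex" begin

text \<open>A convex function lies above its tangents; applied to the negative
  \<open>(cos t - 1) / t\<close> with the tangent at \<open>pi / 2\<close>, this is the claim. The
  second derivative of that function is a trigonometric expression over \<open>t ^ 3\<close>, and
  \<open>two_sin_cos_nonneg\<close> settles its sign.\<close>

text \<open>The expression vanishes at 0, and in its derivative everything cancels except
  \<open>t\<^sup>2 * sin t\<close>, so it is nondecreasing up to \<open>pi\<close>.\<close>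

lemma two_sin_cos_nonneg:
  fixes t :: real
  assumes "0 \<le> t" "t \<le> pi"
  shows "0 \<le> 2 * t * sin t - t\<^sup>2 * cos t - 2 + 2 * cos t"
proof -
  define h where "h = (\<lambda>u::real. 2 * u * sin u - u\<^sup>2 * cos u - 2 + 2 * cos u)"
  have "h 0 \<le> h t"
  proof (rule DERIV_nonneg_imp_nondecreasing[OF assms(1)])
    fix u assume u: "0 \<le> u" "u \<le> t"
    have "(h has_real_derivative u\<^sup>2 * sin u) (at u)"
      unfolding h_def by (auto intro!: derivative_eq_intros simp: algebra_simps)
    moreover have "0 \<le> u\<^sup>2 * sin u"
      using u assms by (intro mult_nonneg_nonneg sin_ge_zero) auto
    ultimately show "\<exists>y. (h has_real_derivative y) (at u) \<and> 0 \<le> y" by blast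
  qed
  then show ?thesis by (simp add: h_def)
qed

theorem theorem7:
  fixes x :: real
  assumes "0 < x" and "x \<le> pi / 2"
  shows "(1 - cos x) / x \<le> 2 / pi + 2 * (pi - 2) / pi\<^sup>2 * (x - pi / 2)"
proof -
  \<comment> \<open>The sign is flipped so that concavity becomes convexity, the form that
    \<open>f''_imp_f'\<close> expects.\<close>
  define f where "f = (\<lambda>t::real. (cos t - 1) / t)"
  define f' where "f' = (\<lambda>t::real. (1 - cos t - t * sin t) / t\<^sup>2)"
  define f'' where "f'' = (\<lambda>t::real. (2 * t * sin t - t\<^sup>2 * cos t - 2 + 2 * cos t) / t ^ 3)"
  have "f' (pi / 2) * (x - pi / 2) \<le> f x - f (pi / 2)"
  \<comment> \<open>The interval omits 0, where the quotient rule breaks down, but keeps the point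
    of tangency.\<close>
  proof (rule f''_imp_f'[of "{0<..pi / 2}" f f' f''])
    fix t :: real assume t: "t \<in> {0<..pi / 2}"
    then show "(f has_real_derivative f' t) (at t)"
      unfolding f_def f'_def
      by (auto intro!: derivative_eq_intros simp: field_simps power2_eq_square)
    from t show "(f' has_real_derivative f'' t) (at t)"
      unfolding f'_def f''_def
      by (auto intro!: derivative_eq_intros simp: field_simps power2_eq_square power3_eq_cube)
    from t show "0 \<le> f'' t"
      unfolding f''_def by (intro divide_nonneg_nonneg two_sin_cos_nonneg) auto
  qed (use assms in auto)
  moreover have "f' (pi / 2) = - (2 * (pi - 2) / pi\<^sup>2)"
    by (simp add: f'_def field_simps power2_eq_square)
  moreover have "f (pi / 2) = - (2 / pi)" "f x = - ((1 - cos x) / x)"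
    by (simp_all add: f_def diff_divide_distrib)
  ultimately show ?thesis by simp
qed

end
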